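(* Let $n \geq 3$ and $r \geq 3$. Then $\Sigma_r(C_n^{c})$ is vertex decomposable, where $C_n^c$ is the complement of the cycle graph $C_n$ on $n$ vertices.
   Context: $\Sigma_r(G)$ is the simplicial complex generated by the sets $V(G)\setminus W$ over all $r$-subsets $W\subseteq V(G)$ with $G[W]$ connected (void complex if none). Vertex decomposable: the complex is a simplex, the empty complex $\{\emptyset\}$, the void complex, or has a vertex $x$ with $\mathrm{lk}(x)$ and $\mathrm{del}(x)$ vertex decomposable and every facet of $\mathrm{del}(x)$ a facet of the complex. *)

theory Defs
  imports "Graph_Theory.Graph_Theory"
begin

section \<open>Abstract simplicial complexes\<close>

text \<open>A complex is given by its set of faces. The void complex is the empty set of faces, the
  empty complex is \<open>{{}}\<close>. A complex need not have every element of the type (or of an ambient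
  vertex set) as a vertex: \<open>x\<close> is a vertex of \<open>\<Delta>\<close> when \<open>{x} \<in> \<Delta>\<close>.\<close>

definition simplicial_complex :: "'a set set \<Rightarrow> bool" where
  "simplicial_complex \<Delta> \<longleftrightarrow>
     finite \<Delta> \<and> (\<forall>\<sigma>\<in>\<Delta>. finite \<sigma>) \<and> (\<forall>\<sigma>\<in>\<Delta>. \<forall>\<tau>. \<tau> \<subseteq> \<sigma> \<longrightarrow> \<tau> \<in> \<Delta>)"

definition generated_complex :: "'a set set \<Rightarrow> 'a set set" where
  "generated_complex \<F> = {\<sigma>. \<exists>F\<in>\<F>. \<sigma> \<subseteq> F}"

definition facets :: "'a set set \<Rightarrow> 'a set set" where
  "facets \<Delta> = {\<sigma>\<in>\<Delta>. \<forall>\<tau>\<in>\<Delta>. \<sigma> \<subseteq> \<tau> \<longrightarrow> \<tau> = \<sigma>}"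

definition lk :: "'a set set \<Rightarrow> 'a \<Rightarrow> 'a set set" where
  "lk \<Delta> x = {\<sigma>. x \<notin> \<sigma> \<and> insert x \<sigma> \<in> \<Delta>}"

definition del :: "'a set set \<Rightarrow> 'a \<Rightarrow> 'a set set" where
  "del \<Delta> x = {\<sigma>\<in>\<Delta>. x \<notin> \<sigma>}"

inductive vertex_decomposable :: "'a set set \<Rightarrow> bool" where
  void: "vertex_decomposable {}"
| empty: "vertex_decomposable {{}}"
| simplex: "finite S \<Longrightarrow> vertex_decomposable (Pow S)"
| shed: "\<lbrakk>simplicial_complex \<Delta>; {x} \<in> \<Delta>;
          vertex_decomposable (lk \<Delta> x); vertex_decomposable (del \<Delta> x);
          facets (del \<Delta> x) \<subseteq> facets \<Delta>\<rbrakk>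
        \<Longrightarrow> vertex_decomposable \<Delta>"


section \<open>Graphs\<close>

text \<open>A finite simple graph is a symmetric loop-free digraph without parallel arcs
  (locale \<^locale>\<open>pair_graph\<close>), each edge being a pair of opposite arcs.\<close>

definition complement_graph :: "'a pair_pre_digraph \<Rightarrow> 'a pair_pre_digraph" where
  "complement_graph G = \<lparr> pverts = pverts G,
     parcs = {(u, v). u \<in> pverts G \<and> v \<in> pverts G \<and> u \<noteq> v \<and> (u, v) \<notin> parcs G} \<rparr>"

text \<open>The cycle on the residues modulo \<open>n\<close>; it is a simple graph, and the usual cycle,
  only for \<open>n \<ge> 3\<close>.\<close>

definition cycle_graph :: "nat \<Rightarrow> nat pair_pre_digraph" where
  "cycle_graph n = \<lparr> pverts = {..<n},
     parcs = {(i, j). i < n \<and> j < n \<and> (j = Suc i mod n \<or> i = Suc j mod n)} \<rparr>"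

text \<open>The induced subgraph is \<open>with_proj G \<restriction> W\<close>. The constant for graph connectedness is qualified
  because \<open>connected\<close> also denotes the topological notion.\<close>

definition Sigma_complex :: "nat \<Rightarrow> 'a pair_pre_digraph \<Rightarrow> 'a set set" where
  "Sigma_complex r G = generated_complex
     {pverts G - W | W. W \<subseteq> pverts G \<and> finite W \<and> card W = r \<and>
        Digraph_Component.connected (with_proj G \<restriction> W)}"


section \<open>Well-formedness\<close>

lemma pair_graph_cycle_graph:
  assumes "n \<ge> 3"
  shows "pair_graph (cycle_graph n)"
proof -
  have fin: "finite (parcs (cycle_graph n))"
    by (rule finite_subset[of _ "{..<n} \<times> {..<n}"]) (auto simp: cycle_graph_def)
  have loopfree: "Suc i mod n \<noteq> i" if "i < n" for i
    using that assms by (cases "Suc i = n") auto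
  show ?thesis
    by unfold_locales
      (use fin loopfree loopfree[symmetric] in \<open>auto simp: cycle_graph_def symmetric_def sym_def\<close>)
qed

lemma pair_graph_complement_graph:
  assumes "pair_graph G"
  shows "pair_graph (complement_graph G)"
proof -
  interpret G: pair_graph G by fact
  have fin: "finite (parcs (complement_graph G))"
    by (rule finite_subset[of _ "pverts G \<times> pverts G"])
      (auto simp: complement_graph_def G.pair_finite_verts)
  have sym: "(v, u) \<in> parcs G" if "(u, v) \<in> parcs G" for u v
    using that G.pair_sym_arcs by (auto simp: symmetric_def sym_def)
  show ?thesis
    by unfold_locales
      (use fin sym G.pair_finite_verts in \<open>auto simp: complement_graph_def symmetric_def sym_def\<close>)
qed

lemma simplicial_complex_Sigma_complex:
  assumes "finite (pverts G)"
  shows "simplicial_complex (Sigma_complex r G)"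
proof -
  have sub: "Sigma_complex r G \<subseteq> Pow (pverts G)"
    by (auto simp: Sigma_complex_def generated_complex_def)
  then have "finite (Sigma_complex r G)"
    using assms by (meson finite_Pow_iff finite_subset)
  moreover have "finite \<sigma>" if "\<sigma> \<in> Sigma_complex r G" for \<sigma>
    using that sub assms by (meson PowD finite_subset subsetD)
  moreover have "\<tau> \<in> Sigma_complex r G" if "\<sigma> \<in> Sigma_complex r G" "\<tau> \<subseteq> \<sigma>" for \<sigma> \<tau>
    using that unfolding Sigma_complex_def generated_complex_def by blast
  ultimately show ?thesis
    by (auto simp: simplicial_complex_def)
qed

lemma simplicial_complex_vertex_decomposable:
  "vertex_decomposable \<Delta> \<Longrightarrow> simplicial_complex \<Delta>"
  by (induction rule: vertex_decomposable.induct)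
    (auto simp: simplicial_complex_def intro: finite_subset)

end

theory Submission
  imports Defs
begin

text \<open>A set \<open>W\<close> of at least three vertices induces a disconnected subgraph of the complement of the
  cycle only if the cycle restricted to \<open>W\<close> is a join, hence only for three consecutive vertices or
  for \<open>n = |W| = 4\<close>. So for \<open>r \<ge> 4\<close> the complex is a skeleton of a simplex, or trivial. For \<open>r = 3\<close>
  shed the vertices in decreasing order. The links are the same kind of complex on a path. The
  deletions are generated by complements of pairs \<open>{a, b}\<close> outside a forest of paths, and such
  complexes are vertex decomposable along a perfect elimination order of the excluded pairs.\<close>

section \<open>Complexes generated by the complements of \<open>r\<close>-sets\<close>

text \<open>Here \<open>B\<close> is the family of excluded \<open>r\<close>-sets; its members of other sizes are irrelevant.\<close>

definition co_complex :: "'a set \<Rightarrow> nat \<Rightarrow> 'a set set \<Rightarrow> 'a set set" where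
  "co_complex V r B = {\<sigma>. \<exists>W\<subseteq>V. card W = r \<and> W \<notin> B \<and> \<sigma> \<subseteq> V - W}"

lemma simplicial_complex_co_complex:
  assumes "finite V"
  shows "simplicial_complex (co_complex V r B)"
proof -
  have sub: "co_complex V r B \<subseteq> Pow V"
    by (auto simp: co_complex_def)
  then have "finite (co_complex V r B)"
    using assms by (meson finite_Pow_iff finite_subset)
  moreover have "finite \<sigma>" if "\<sigma> \<in> co_complex V r B" for \<sigma>
    using that sub assms by (meson PowD finite_subset subsetD)
  moreover have "\<tau> \<in> co_complex V r B" if "\<sigma> \<in> co_complex V r B" "\<tau> \<subseteq> \<sigma>" for \<sigma> \<tau>
    using that unfolding co_complex_def by blast
  ultimately show ?thesis
    by (auto simp: simplicial_complex_def)
qed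

lemma co_complex_cong:
  assumes "\<And>W. W \<subseteq> V \<Longrightarrow> card W = r \<Longrightarrow> W \<in> B \<longleftrightarrow> W \<in> B'"
  shows "co_complex V r B = co_complex V r B'"
  using assms unfolding co_complex_def by blast

lemma co_complex_void:
  assumes "\<And>W. W \<subseteq> V \<Longrightarrow> card W = r \<Longrightarrow> W \<in> B"
  shows "co_complex V r B = {}"
  using assms unfolding co_complex_def by blast

text \<open>A face containing \<open>x\<close> lies in \<open>V - W\<close> only if
  \<open>x \<notin> W\<close>. So the link merely drops \<open>x\<close> from the ground set and
  keeps \<open>r\<close> and \<open>B\<close>.\<close>

lemma lk_co_complex:
  assumes "x \<in> V"
  shows "lk (co_complex V r B) x = co_complex (V - {x}) r B"
  using assms unfolding lk_def co_complex_def by blast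

text \<open>If \<open>x \<in> W\<close>, cutting \<open>x\<close> out of \<open>W\<close> gives the
  smaller removed set. Otherwise \<open>exch\<close> trades some \<open>w \<in> W\<close> for
  \<open>x\<close>: a face avoiding \<open>x\<close> and \<open>W\<close> also avoids the permitted
  set \<open>insert x (W - {w})\<close>. Thus \<open>exch\<close> is the shedding condition in terms
  of removed sets.\<close>

lemma del_co_complex:
  assumes "finite V" "x \<in> V"
    and exch: "\<And>W. W \<subseteq> V - {x} \<Longrightarrow> card W = Suc k \<Longrightarrow> W \<notin> B
      \<Longrightarrow> \<exists>w\<in>W. insert x (W - {w}) \<notin> B"
  shows "del (co_complex V (Suc k) B) x = co_complex (V - {x}) k {W. insert x W \<in> B}"
proof (intro equalityI subsetI)
  fix \<sigma> assume "\<sigma> \<in> del (co_complex V (Suc k) B) x"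
  then obtain W where W: "W \<subseteq> V" "card W = Suc k" "W \<notin> B" "\<sigma> \<subseteq> V - W" "x \<notin> \<sigma>"
    by (auto simp: del_def co_complex_def)
  have fin: "finite W"
    using W(1) assms(1) by (rule finite_subset)
  obtain U where U: "U \<subseteq> W" "U \<subseteq> V - {x}" "card U = k" "insert x U \<notin> B"
  proof (cases "x \<in> W")
    case True
    show ?thesis
      by (rule that[of "W - {x}"]) (use True W fin in \<open>auto simp: insert_absorb\<close>)
  next
    case False
    then obtain w where w: "w \<in> W" "insert x (W - {w}) \<notin> B"
      using exch[of W] W by blast
    show ?thesis
      by (rule that[of "W - {w}"]) (use False W w fin in auto)
  qed
  then show "\<sigma> \<in> co_complex (V - {x}) k {W. insert x W \<in> B}"
    using W unfolding co_complex_def by blast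
next
  fix \<sigma> assume "\<sigma> \<in> co_complex (V - {x}) k {W. insert x W \<in> B}"
  then obtain U where U: "U \<subseteq> V - {x}" "card U = k" "insert x U \<notin> B" "\<sigma> \<subseteq> V - {x} - U"
    by (auto simp: co_complex_def)
  have "card (insert x U) = Suc k"
    using U finite_subset[OF U(1)] assms(1) by (subst card_insert_disjoint) auto
  then show "\<sigma> \<in> del (co_complex V (Suc k) B) x"
    using U assms(2) by (auto simp: del_def co_complex_def intro!: exI[of _ "insert x U"])
qed

text \<open>All generators \<open>V - W\<close> have the same size, so none lies properly inside
  another.\<close>

lemma facets_co_complex:
  assumes "finite V"
  shows "facets (co_complex V r B) = {V - W | W. W \<subseteq> V \<and> card W = r \<and> W \<notin> B}"
proof (intro equalityI subsetI)
  fix \<sigma> assume "\<sigma> \<in> facets (co_complex V r B)"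
  then have \<sigma>: "\<sigma> \<in> co_complex V r B"
    and max: "\<And>\<tau>. \<tau> \<in> co_complex V r B \<Longrightarrow> \<sigma> \<subseteq> \<tau> \<Longrightarrow> \<tau> = \<sigma>"
    by (auto simp: facets_def)
  from \<sigma> obtain W where W: "W \<subseteq> V" "card W = r" "W \<notin> B" "\<sigma> \<subseteq> V - W"
    unfolding co_complex_def by blast
  have "V - W \<in> co_complex V r B"
    using W by (auto simp: co_complex_def)
  then show "\<sigma> \<in> {V - W | W. W \<subseteq> V \<and> card W = r \<and> W \<notin> B}"
    using max[of "V - W"] W by auto
next
  fix \<sigma> assume "\<sigma> \<in> {V - W | W. W \<subseteq> V \<and> card W = r \<and> W \<notin> B}"
  then obtain W where W: "W \<subseteq> V" "card W = r" "W \<notin> B" "\<sigma> = V - W"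
    by blast
  have "\<tau> = \<sigma>" if "\<tau> \<in> co_complex V r B" "\<sigma> \<subseteq> \<tau>" for \<tau>
  proof -
    obtain U where U: "U \<subseteq> V" "card U = r" "\<tau> \<subseteq> V - U"
      using \<open>\<tau> \<in> _\<close> by (auto simp: co_complex_def)
    have "U \<subseteq> W"
      using that(2) U W by blast
    then have "U = W"
      using U W assms by (metis card_subset_eq finite_subset)
    then show ?thesis
      using that(2) U W by blast
  qed
  moreover have "\<sigma> \<in> co_complex V r B"
    using W by (auto simp: co_complex_def)
  ultimately show "\<sigma> \<in> facets (co_complex V r B)"
    by (auto simp: facets_def)
qed

text \<open>The recursion for all families below: the link keeps the size and \<open>B\<close>,
  while the deletion lowers the size by one and replaces \<open>B\<close> by its link at
  \<open>x\<close>. A facet of the deletion is the complement in \<open>V\<close> of some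
  \<open>insert x U\<close>, hence already a facet.\<close>

lemma vertex_decomposable_co_complex_shed:
  assumes "finite V" "x \<in> V"
    and exch: "\<And>W. W \<subseteq> V - {x} \<Longrightarrow> card W = Suc k \<Longrightarrow> W \<notin> B
      \<Longrightarrow> \<exists>w\<in>W. insert x (W - {w}) \<notin> B"
    and lk: "vertex_decomposable (co_complex (V - {x}) (Suc k) B)"
    and del: "vertex_decomposable (co_complex (V - {x}) k {W. insert x W \<in> B})"
  shows "vertex_decomposable (co_complex V (Suc k) B)"
proof -
  have del_eq: "del (co_complex V (Suc k) B) x = co_complex (V - {x}) k {W. insert x W \<in> B}"
    using assms(1,2) exch by (rule del_co_complex)
  show ?thesis
  proof (cases "{x} \<in> co_complex V (Suc k) B")
    case True
    have "facets (del (co_complex V (Suc k) B) x) \<subseteq> facets (co_complex V (Suc k) B)"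
    proof
      fix \<sigma> assume "\<sigma> \<in> facets (del (co_complex V (Suc k) B) x)"
      then obtain U where U: "U \<subseteq> V - {x}" "card U = k" "insert x U \<notin> B" "\<sigma> = V - {x} - U"
        unfolding del_eq using assms(1) by (auto simp: facets_co_complex)
      have "card (insert x U) = Suc k"
        using U finite_subset[OF U(1)] assms(1) by (subst card_insert_disjoint) auto
      then show "\<sigma> \<in> facets (co_complex V (Suc k) B)"
        using U assms(1,2) by (auto simp: facets_co_complex intro!: exI[of _ "insert x U"])
    qed
    with True show ?thesis
      using simplicial_complex_co_complex[OF assms(1)] lk del del_eq lk_co_complex[OF assms(2)]
      by (metis vertex_decomposable.shed)
  next
    case False
    \<comment> \<open>The rule \<open>shed\<close> requires a vertex. A point of \<open>V\<close>
      that is none lies in no face, so the complex is its own deletion.\<close>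
    then have "x \<notin> \<sigma>" if "\<sigma> \<in> co_complex V (Suc k) B" for \<sigma>
      using that unfolding co_complex_def by blast
    then have "co_complex V (Suc k) B = del (co_complex V (Suc k) B) x"
      unfolding del_def by blast
    then show ?thesis
      using del del_eq by simp
  qed
qed

section \<open>Skeleta of simplices, and removed sets of size at most two\<close>

lemma vertex_decomposable_co_complex_0:
  assumes "finite V"
  shows "vertex_decomposable (co_complex V 0 B)"
proof (cases "{} \<in> B")
  case True
  \<comment> \<open>\<open>card\<close> is 0 on infinite sets too; finiteness of \<open>V\<close>
    leaves only the empty \<open>W\<close>.\<close>
  then have "co_complex V 0 B = {}"
    using assms by (intro co_complex_void) (auto dest: finite_subset)
  then show ?thesis
    by (simp add: vertex_decomposable.void)
next
  case False
  then have "co_complex V 0 B = Pow V"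
    by (fastforce simp: co_complex_def)
  then show ?thesis
    using assms by (simp add: vertex_decomposable.simplex)
qed

text \<open>At most \<open>V\<close> itself can be removed, so no face other than the empty set is
  possible.\<close>

lemma vertex_decomposable_co_complex_le:
  assumes "finite V" "card V \<le> r"
  shows "vertex_decomposable (co_complex V r B)"
proof -
  have "W = V" if "W \<subseteq> V" "card W = r" for W
    using that assms by (metis card_mono card_subset_eq le_antisym)
  then have "co_complex V r B \<subseteq> {{}}"
    unfolding co_complex_def by blast
  then have "co_complex V r B = {} \<or> co_complex V r B = {{}}"
    by blast
  then show ?thesis
    by (elim disjE) (simp_all add: vertex_decomposable.void vertex_decomposable.empty)
qed

text \<open>The complex is a skeleton of the simplex on \<open>V\<close>, or void. Every exchange is
  permitted, so any vertex can be shed; \<open>r\<close> and \<open>B\<close> vary in the induction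
  because the deletion changes both.\<close>

lemma vertex_decomposable_co_complex_uniform:
  assumes "finite V" "\<And>W. W \<subseteq> V \<Longrightarrow> card W = r \<Longrightarrow> W \<notin> B"
  shows "vertex_decomposable (co_complex V r B)"
  using assms
proof (induction V arbitrary: r B rule: finite_induct)
  case empty
  then show ?case
    by (intro vertex_decomposable_co_complex_le) auto
next
  case (insert x V)
  show ?case
  proof (cases r)
    case 0
    then show ?thesis
      using insert.hyps by (simp add: vertex_decomposable_co_complex_0)
  next
    case (Suc k)
    \<comment> \<open>This supplies both the exchange condition and the hypothesis for the
      deletion.\<close>
    have big: "insert x W \<notin> B" if "W \<subseteq> V" "card W = k" for W
      using that insert.hyps Suc finite_subset[OF that(1)]
      by (intro insert.prems) (auto simp: card_insert_if)
    show ?thesis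
      unfolding Suc
    proof (rule vertex_decomposable_co_complex_shed[of _ x])
      show "finite (insert x V)"
        using insert.hyps by simp
      fix W assume W: "W \<subseteq> insert x V - {x}" "card W = Suc k" "W \<notin> B"
      then obtain w where "w \<in> W"
        by fastforce
      moreover from this have "insert x (W - {w}) \<notin> B"
        using W by (intro big) auto
      ultimately show "\<exists>w\<in>W. insert x (W - {w}) \<notin> B"
        by blast
    next
      show "vertex_decomposable (co_complex (insert x V - {x}) (Suc k) B)"
        using insert.hyps insert.prems Suc by (auto intro!: insert.IH)
      show "vertex_decomposable (co_complex (insert x V - {x}) k {W. insert x W \<in> B})"
        using insert.hyps big by (auto intro!: insert.IH)
    qed auto
  qed
qed

text \<open>Any permitted \<open>x\<close> can be shed, since exchanging the only element of
  \<open>W\<close> for \<open>x\<close> gives \<open>{x}\<close>; the deletion is then a full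
  simplex.\<close>

lemma vertex_decomposable_co_complex_1:
  assumes "finite V"
  shows "vertex_decomposable (co_complex V 1 B)"
  using assms
proof (induction V rule: finite_psubset_induct)
  case (psubset V)
  show ?case
  proof (cases "\<exists>x\<in>V. {x} \<notin> B")
    case True
    then obtain x where x: "x \<in> V" "{x} \<notin> B"
      by blast
    show ?thesis
      unfolding One_nat_def
    proof (rule vertex_decomposable_co_complex_shed[of _ x])
      fix W assume "W \<subseteq> V - {x}" "card W = Suc 0"
      then obtain w where "W = {w}"
        by (metis One_nat_def card_1_singletonE)
      then show "\<exists>w\<in>W. insert x (W - {w}) \<notin> B"
        using x by simp
    next
      show "vertex_decomposable (co_complex (V - {x}) (Suc 0) B)"
        unfolding One_nat_def[symmetric] using x(1) by (intro psubset.IH) blast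
      show "vertex_decomposable (co_complex (V - {x}) 0 {W. insert x W \<in> B})"
        using psubset.hyps by (intro vertex_decomposable_co_complex_0) simp
    qed (use psubset.hyps x(1) in simp_all)
  next
    case False
    then have "co_complex V 1 B = {}"
      by (intro co_complex_void) (metis card_1_singletonE insert_subset)
    then show ?thesis
      by (simp add: vertex_decomposable.void)
  qed
qed

text \<open>The hypothesis says that the graph of the edges in \<open>B\<close> is chordal, in the form of a
  perfect elimination order.\<close>

lemma vertex_decomposable_co_complex_2:
  assumes "finite V"
    and "\<And>U. U \<subseteq> V \<Longrightarrow> U \<noteq> {} \<Longrightarrow> \<exists>x\<in>U. \<forall>a\<in>U - {x}. \<forall>b\<in>U - {x}.
      a \<noteq> b \<longrightarrow> {x, a} \<in> B \<longrightarrow> {x, b} \<in> B \<longrightarrow> {a, b} \<in> B"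
  shows "vertex_decomposable (co_complex V 2 B)"
  using assms
proof (induction V rule: finite_psubset_induct)
  case (psubset V)
  show ?case
  proof (cases "V = {}")
    case True
    then show ?thesis
      by (intro vertex_decomposable_co_complex_le) auto
  next
    case False
    then obtain x where x: "x \<in> V" "\<And>a b. a \<in> V - {x} \<Longrightarrow> b \<in> V - {x} \<Longrightarrow> a \<noteq> b \<Longrightarrow>
        {x, a} \<in> B \<Longrightarrow> {x, b} \<in> B \<Longrightarrow> {a, b} \<in> B"
      using psubset.prems[of V] by blast
    show ?thesis
      unfolding numeral_2_eq_2
    proof (rule vertex_decomposable_co_complex_shed[of _ x])
      fix W assume W: "W \<subseteq> V - {x}" "card W = Suc (Suc 0)" "W \<notin> B"
      then obtain a b where ab: "W = {a, b}" "a \<noteq> b"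
        by (auto simp: card_Suc_eq)
      \<comment> \<open>\<open>x\<close> is simplicial in the graph of excluded pairs: if both
        exchanges were excluded, \<open>a\<close> and \<open>b\<close> would be neighbours of
        \<open>x\<close>, hence joined, contrary to \<open>W \<notin> B\<close>.\<close>
      then have "{x, a} \<notin> B \<or> {x, b} \<notin> B"
        using x W by blast
      moreover have "W - {a} = {b}" "W - {b} = {a}"
        using ab by auto
      ultimately show "\<exists>w\<in>W. insert x (W - {w}) \<notin> B"
        using ab by auto
    next
      show "vertex_decomposable (co_complex (V - {x}) (Suc (Suc 0)) B)"
        unfolding numeral_2_eq_2[symmetric]
      proof (rule psubset.IH)
        show "V - {x} \<subset> V"
          using x by blast
        fix U assume "U \<subseteq> V - {x}" "U \<noteq> {}"
        then show "\<exists>x\<in>U. \<forall>a\<in>U - {x}. \<forall>b\<in>U - {x}.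
            a \<noteq> b \<longrightarrow> {x, a} \<in> B \<longrightarrow> {x, b} \<in> B \<longrightarrow> {a, b} \<in> B"
          using psubset.prems[of U] by blast
      qed
    next
      show "vertex_decomposable (co_complex (V - {x}) (Suc 0) {W. insert x W \<in> B})"
        unfolding One_nat_def[symmetric]
        using psubset.hyps by (intro vertex_decomposable_co_complex_1) simp
    qed (use psubset.hyps x(1) in simp_all)
  qed
qed

section \<open>Consecutive triples on paths and cycles\<close>

text \<open>Shed the end \<open>m\<close> of the path. The link is the complex of the shorter path;
  the deletion has at most one excluded pair, so its graph is chordal. Triples reaching outside the
  ground set never occur as \<open>W\<close>, so one family \<open>?T\<close> serves for all
  \<open>m\<close>.\<close>

lemma vertex_decomposable_path_triples:
  "vertex_decomposable (co_complex {..<m} 3 (range (\<lambda>i. {i, Suc i, Suc (Suc i)})))"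
    (is "vertex_decomposable (co_complex _ _ ?T)")
proof (induction m)
  case 0
  show ?case
    by (intro vertex_decomposable_co_complex_le) auto
next
  case (Suc m)
  have V: "{..<Suc m} - {m} = {..<m}"
    by auto
  \<comment> \<open>\<open>m\<close> is the largest element of \<open>insert m U\<close>, so it ends
    the triple. This gives \<open>m = Suc (Suc i)\<close>, and the subtractions are not
    truncated.\<close>
  have top: "U = {m - 2, m - 1}" if "U \<subseteq> {..<m}" and T: "insert m U \<in> ?T" for U
  proof -
    obtain i where i: "insert m U = {i, Suc i, Suc (Suc i)}"
      using T by blast
    have "Suc (Suc i) \<in> insert m U"
      unfolding i by simp
    moreover have "m \<in> {i, Suc i, Suc (Suc i)}"
      unfolding i[symmetric] by simp
    ultimately have m: "m = Suc (Suc i)"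
      using that(1) by auto
    have "U = insert m U - {m}"
      using that(1) by auto
    also have "\<dots> = {m - 2, m - 1}"
      unfolding i by (auto simp: m)
    finally show ?thesis .
  qed
  show ?case
    unfolding numeral_3_eq_3
  proof (rule vertex_decomposable_co_complex_shed[of _ m], unfold V)
    fix W assume W: "W \<subseteq> {..<m}" "card W = Suc (Suc (Suc 0))"
    then obtain a b where ab: "a \<in> W" "b \<in> W" "a \<noteq> b"
      by (auto simp: card_Suc_eq)
    show "\<exists>w\<in>W. insert m (W - {w}) \<notin> ?T"
    proof (rule ccontr)
      assume neg: "\<not> ?thesis"
      \<comment> \<open>If all exchanges were excluded, removing any element from \<open>W\<close>
        would leave the same pair.\<close>
      have "W - {w} = {m - 2, m - 1}" if "w \<in> W" for w
        using that neg W(1) by (intro top) blast+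
      then have "W - {a} = W - {b}"
        using ab by simp
      then show False
        using ab by blast
    qed
  next
    show "vertex_decomposable (co_complex {..<m} (Suc (Suc (Suc 0))) ?T)"
      using Suc.IH by (simp only: numeral_3_eq_3)
  next
    have edge: "{x, a} = {m - 2, m - 1}"
      if "x < m" "a < m" "{x, a} \<in> {U. insert m U \<in> ?T}" for x a
      using that by (intro top) auto
    show "vertex_decomposable (co_complex {..<m} (Suc (Suc 0)) {U. insert m U \<in> ?T})"
      unfolding numeral_2_eq_2[symmetric]
    proof (rule vertex_decomposable_co_complex_2)
      fix U assume U: "U \<subseteq> {..<m}" "U \<noteq> {}"
      \<comment> \<open>Any \<open>x\<close> serves: with at most one excluded pair it has at most
        one neighbour.\<close>
      then obtain x where x: "x \<in> U"
        by blast
      have eq: "a = b" if "a \<in> U" "b \<in> U" "{x, a} \<in> {U. insert m U \<in> ?T}"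
        "{x, b} \<in> {U. insert m U \<in> ?T}" for a b
      proof -
        have "x < m" "a < m" "b < m"
          using that(1,2) x U(1) by auto
        then have "{x, a} = {x, b}"
          using that(3,4) edge[of x a] edge[of x b] by simp
        then show ?thesis
          by (auto simp: doubleton_eq_iff)
      qed
      show "\<exists>x\<in>U. \<forall>a\<in>U - {x}. \<forall>b\<in>U - {x}. a \<noteq> b \<longrightarrow>
          {x, a} \<in> {U. insert m U \<in> ?T} \<longrightarrow> {x, b} \<in> {U. insert m U \<in> ?T} \<longrightarrow>
          {a, b} \<in> {U. insert m U \<in> ?T}"
      proof (intro bexI[OF _ x] ballI impI)
        fix a b
        assume "a \<in> U - {x}" "b \<in> U - {x}" "a \<noteq> b"
          "{x, a} \<in> {U. insert m U \<in> ?T}" "{x, b} \<in> {U. insert m U \<in> ?T}"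
        then show "{a, b} \<in> {U. insert m U \<in> ?T}"
          using eq[of a b] by simp
      qed
    qed simp
  qed auto
qed

text \<open>The vertex sets of the three-vertex paths in the cycle.\<close>

definition cyclic_triples :: "nat \<Rightarrow> nat set set" where
  "cyclic_triples n = (\<lambda>i. {i, Suc i mod n, Suc (Suc i) mod n}) ` {..<n}"

text \<open>Separates the three triples through the last vertex \<open>m\<close> from those inside
  the path below \<open>m\<close>, where the reduction modulo \<open>Suc m\<close> has no
  effect.\<close>

lemma cyclic_triples_Suc:
  assumes "m \<ge> 2"
  shows "cyclic_triples (Suc m) =
    insert {m - 2, m - 1, m} (insert {m - 1, m, 0} (insert {m, 0, 1}
      ((\<lambda>i. {i, Suc i, Suc (Suc i)}) ` {..<m - 2})))"
proof -
  have split: "{..<Suc m} = insert (m - 2) (insert (m - 1) (insert m {..<m - 2}))"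
    using assms by auto
  have "(\<lambda>i. {i, Suc i mod Suc m, Suc (Suc i) mod Suc m}) ` {..<m - 2} =
      (\<lambda>i. {i, Suc i, Suc (Suc i)}) ` {..<m - 2}"
    by (intro image_cong) auto
  moreover have "Suc (m - 2) = m - 1" "Suc (m - 1) = m" "m - 1 < Suc m" "Suc (Suc m) mod Suc m = 1"
    using assms by (auto simp: mod_Suc)
  ultimately show ?thesis
    using assms unfolding cyclic_triples_def split by simp
qed

text \<open>Shedding the last vertex \<open>m\<close> cuts the cycle: the link is the path complex,
  and the excluded pairs of the deletion lie in \<open>P\<close>, a path on four vertices.\<close>

lemma vertex_decomposable_cyclic_triples:
  assumes "n \<ge> 5"
  shows "vertex_decomposable (co_complex {..<n} 3 (cyclic_triples n))"
proof -
  obtain m where n: "n = Suc m" and m: "m \<ge> 4"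
    using assms by (cases n) auto
  then have m2: "m \<ge> 2"
    by simp
  define P where "P = {{m - 2, m - 1}, {m - 1, 0}, {0, 1}}"
  \<comment> \<open>Here \<open>m \<ge> 4\<close> enters: for \<open>m = 3\<close> the ends
    \<open>m - 2\<close> and \<open>1\<close> would coincide and \<open>P\<close> would close to a
    triangle.\<close>
  have neq: "m - 2 \<noteq> m - 1" "m - 2 \<noteq> 0" "m - 2 \<noteq> 1" "m - 1 \<noteq> 0" "m - 1 \<noteq> 1"
    using m by auto
  have P_iff: "{u, v} \<in> P \<longleftrightarrow> u = m - 2 \<and> v = m - 1 \<or> u = m - 1 \<and> v = m - 2 \<or>
      u = m - 1 \<and> v = 0 \<or> u = 0 \<and> v = m - 1 \<or> u = 0 \<and> v = 1 \<or> u = 1 \<and> v = 0" for u v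
    unfolding P_def by (simp add: doubleton_eq_iff)
  have V: "{..<Suc m} - {m} = {..<m}"
    by auto
  have top: "U \<in> P" if "U \<subseteq> {..<m}" "insert m U \<in> cyclic_triples (Suc m)" for U
  proof -
    have U: "U = insert m U - {m}"
      using that(1) by auto
    have "insert m U \<notin> (\<lambda>i. {i, Suc i, Suc (Suc i)}) ` {..<m - 2}"
    proof
      assume "insert m U \<in> (\<lambda>i. {i, Suc i, Suc (Suc i)}) ` {..<m - 2}"
      then obtain i where i: "i < m - 2" "insert m U = {i, Suc i, Suc (Suc i)}"
        by blast
      then have "m \<in> {i, Suc i, Suc (Suc i)}"
        by (metis insertI1)
      then show False
        using i(1) by auto
    qed
    then have "insert m U \<in> {{m - 2, m - 1, m}, {m - 1, m, 0}, {m, 0, 1}}"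
      using that(2) m by (simp add: cyclic_triples_Suc)
    moreover have ne: "m - 2 \<noteq> m" "m - 1 \<noteq> m" "0 \<noteq> m" "1 \<noteq> m"
      using m by auto
    moreover have "{m - 2, m - 1, m} - {m} = {m - 2, m - 1}" "{m - 1, m, 0} - {m} = {m - 1, 0}"
      "{m, 0, 1} - {m} = {0, 1}"
      using ne by (simp_all add: insert_Diff_if)
    ultimately show ?thesis
      unfolding P_def using U by (metis insert_iff singletonD)
  qed
  have edge: "{x, a} \<in> P"
    if "x < m" "a < m" "{x, a} \<in> {U. insert m U \<in> cyclic_triples (Suc m)}" for x a
    using that by (intro top) auto
  show ?thesis
    unfolding n numeral_3_eq_3
  proof (rule vertex_decomposable_co_complex_shed[of _ m], unfold V)
    fix W assume W: "W \<subseteq> {..<m}" "card W = Suc (Suc (Suc 0))"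
    then obtain a b c where abc: "W = {a, b, c}" "a \<noteq> b" "a \<noteq> c" "b \<noteq> c"
      by (auto simp: card_Suc_eq)
    show "\<exists>w\<in>W. insert m (W - {w}) \<notin> cyclic_triples (Suc m)"
    proof (rule ccontr)
      assume "\<not> ?thesis"
      \<comment> \<open>If every exchange failed, the three pairs in \<open>W\<close> would form a
        triangle in the path \<open>P\<close>.\<close>
      then have "W - {w} \<in> P" if "w \<in> W" for w
        using that W(1) by (intro top) blast+
      then have "W - {a} \<in> P" "W - {b} \<in> P" "W - {c} \<in> P"
        using abc(1) by blast+
      moreover have "W - {a} = {b, c}" "W - {b} = {a, c}" "W - {c} = {a, b}"
        using abc by auto
      ultimately have "{b, c} \<in> P" "{a, c} \<in> P" "{a, b} \<in> P"
        by simp_all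
      then show False
        using abc(2-4) neq unfolding P_iff by metis
    qed
  next
    \<comment> \<open>For the link: among subsets of \<open>{..<m}\<close>, the triples of the cycle
      are exactly those of the path.\<close>
    have "W \<in> cyclic_triples (Suc m) \<longleftrightarrow> W \<in> range (\<lambda>i. {i, Suc i, Suc (Suc i)})"
      if "W \<subseteq> {..<m}" for W
    proof
      assume "W \<in> cyclic_triples (Suc m)"
      moreover have "W \<noteq> {m - 2, m - 1, m}" "W \<noteq> {m - 1, m, 0}" "W \<noteq> {m, 0, 1}"
        using that by blast+
      ultimately have "W \<in> (\<lambda>i. {i, Suc i, Suc (Suc i)}) ` {..<m - 2}"
        unfolding cyclic_triples_Suc[OF m2] by (simp only: insert_iff simp_thms)
      then show "W \<in> range (\<lambda>i. {i, Suc i, Suc (Suc i)})"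
        by blast
    next
      assume "W \<in> range (\<lambda>i. {i, Suc i, Suc (Suc i)})"
      then obtain i where i: "W = {i, Suc i, Suc (Suc i)}"
        by blast
      then have "Suc (Suc i) < m"
        using that by blast
      then have "i < m - 2"
        by linarith
      then show "W \<in> cyclic_triples (Suc m)"
        unfolding i cyclic_triples_Suc[OF m2] by blast
    qed
    then have "co_complex {..<m} 3 (cyclic_triples (Suc m)) =
        co_complex {..<m} 3 (range (\<lambda>i. {i, Suc i, Suc (Suc i)}))"
      by (intro co_complex_cong)
    then show "vertex_decomposable (co_complex {..<m} (Suc (Suc (Suc 0))) (cyclic_triples (Suc m)))"
      using vertex_decomposable_path_triples by (simp only: numeral_3_eq_3)
  next
    show "vertex_decomposable
        (co_complex {..<m} (Suc (Suc 0)) {U. insert m U \<in> cyclic_triples (Suc m)})"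
      unfolding numeral_2_eq_2[symmetric]
    proof (rule vertex_decomposable_co_complex_2)
      fix U assume U: "U \<subseteq> {..<m}" "U \<noteq> {}"
      \<comment> \<open>The excluded pairs form the path 1, 0, m - 1, m - 2; x is a leaf of its restriction to U.\<close>
      obtain x where x: "x \<in> U" "x = 1 \<or> 1 \<notin> U \<and> (x = 0 \<or> 0 \<notin> U)"
      proof -
        obtain y where "y \<in> U"
          using U(2) by blast
        then show ?thesis
          using that[of 0] that[of 1] that[of y] by blast
      qed
      have lt: "a < m" if "a \<in> U" for a
        using that U(1) by blast
      have eq: "a = b" if "a \<in> U" "b \<in> U" "{x, a} \<in> P" "{x, b} \<in> P" for a b
        using that x(2) neq by (auto simp: P_iff)
      show "\<exists>x\<in>U. \<forall>a\<in>U - {x}. \<forall>b\<in>U - {x}. a \<noteq> b \<longrightarrow>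
          {x, a} \<in> {U. insert m U \<in> cyclic_triples (Suc m)} \<longrightarrow>
          {x, b} \<in> {U. insert m U \<in> cyclic_triples (Suc m)} \<longrightarrow>
          {a, b} \<in> {U. insert m U \<in> cyclic_triples (Suc m)}"
      proof (intro bexI[OF _ x(1)] ballI impI)
        fix a b
        assume "a \<in> U - {x}" "b \<in> U - {x}" "a \<noteq> b"
          "{x, a} \<in> {U. insert m U \<in> cyclic_triples (Suc m)}"
          "{x, b} \<in> {U. insert m U \<in> cyclic_triples (Suc m)}"
        then show "{a, b} \<in> {U. insert m U \<in> cyclic_triples (Suc m)}"
          using eq[of a b] edge[of x a] edge[of x b] lt x(1) by simp
      qed
    qed simp
  qed auto
qed

section \<open>Connectedness of induced subgraphs of the complement\<close>

text \<open>Symmetrizing a symmetric arc set changes nothing, and \<open>rtrancl_on W\<close>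
  already confines walks to \<open>W\<close>. Nonemptiness is part of
  \<open>strongly_connected\<close>.\<close>

lemma connected_induced_iff:
  assumes "sym (parcs G)"
  shows "Digraph_Component.connected (with_proj G \<restriction> W) \<longleftrightarrow>
    W \<noteq> {} \<and> (\<forall>u\<in>W. \<forall>v\<in>W. (u, v) \<in> rtrancl_on W (parcs G))"
proof -
  let ?E = "{(u, v) \<in> parcs G. u \<in> W \<and> v \<in> W}"
  have "parcs (mk_symmetric (with_proj G \<restriction> W)) = ?E"
    using assms by (auto simp: parcs_mk_symmetric induce_subgraph_def sym_def)
  moreover have "(u, v) \<in> rtrancl_on W ?E \<longleftrightarrow> (u, v) \<in> rtrancl_on W (parcs G)" for u v
  proof
    assume "(u, v) \<in> rtrancl_on W (parcs G)"
    then show "(u, v) \<in> rtrancl_on W ?E"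
      by (induction rule: rtrancl_on_induct) (auto intro: rtrancl_on_into_rtrancl_on)
  qed (auto intro: rtrancl_on_mono[of ?E _ W])
  ultimately show ?thesis
    by (simp add: connected_def strongly_connected_def reachable_def)
qed

text \<open>A walk from \<open>m\<close> to another vertex of \<open>W\<close> would have to begin
  with an arc from \<open>m\<close> into \<open>W\<close>.\<close>

lemma not_connected_isolated:
  assumes "sym (parcs G)" "m \<in> W" "W \<noteq> {m}" "\<And>w. w \<in> W \<Longrightarrow> (m, w) \<notin> parcs G"
  shows "\<not> Digraph_Component.connected (with_proj G \<restriction> W)"
proof
  assume con: "Digraph_Component.connected (with_proj G \<restriction> W)"
  obtain w where w: "w \<in> W" "w \<noteq> m"
    using assms(2,3) by blast
  then have "(m, w) \<in> rtrancl_on W (parcs G)"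
    using con assms(2) unfolding connected_induced_iff[OF assms(1)] by blast
  then show False
  proof (cases rule: converse_rtrancl_on_cases)
    case base
    then show False
      using w(2) by simp
  next
    case (step c)
    have "c \<in> W"
      using step(2) by (rule in_rtrancl_on_in_F)
    then show False
      using step(1) assms(4) by blast
  qed
qed

lemma rtrancl_on_edge: "(u, v) \<in> r \<Longrightarrow> u \<in> F \<Longrightarrow> v \<in> F \<Longrightarrow> (u, v) \<in> rtrancl_on F r"
  by (auto intro: rtrancl_on_into_rtrancl_on)

abbreviation co_cycle :: "nat \<Rightarrow> nat pair_pre_digraph" where
  "co_cycle n \<equiv> complement_graph (cycle_graph n)"

lemma sym_co_cycle: "sym (parcs (co_cycle n))"
  by (auto simp: complement_graph_def cycle_graph_def sym_def)

lemma pverts_co_cycle: "pverts (co_cycle n) = {..<n}"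
  by (simp add: complement_graph_def cycle_graph_def)

lemma parcs_co_cycle_iff:
  assumes "i < n" "j < n"
  shows "(i, j) \<in> parcs (co_cycle n) \<longleftrightarrow> i \<noteq> j \<and> j \<noteq> Suc i mod n \<and> i \<noteq> Suc j mod n"
  using assms by (auto simp: complement_graph_def cycle_graph_def)

text \<open>Makes the disconnected vertex sets the excluded family, so that only these sets have to
  be determined.\<close>

lemma Sigma_complex_co_cycle:
  "Sigma_complex r (co_cycle n) = co_complex {..<n} r
    {W. \<not> Digraph_Component.connected (with_proj (co_cycle n) \<restriction> W)}"
proof -
  have "finite W" if "W \<subseteq> {..<n}" for W
    using that finite_subset by blast
  then show ?thesis
    unfolding Sigma_complex_def generated_complex_def co_complex_def pverts_co_cycle
    by (intro Collect_cong) (simp only: Bex_def mem_Collect_eq, metis)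
qed

lemma Suc_mod_inject: "i < n \<Longrightarrow> j < n \<Longrightarrow> Suc i mod n = Suc j mod n \<Longrightarrow> i = j"
  by (auto simp: mod_Suc split: if_splits)

text \<open>Consecutive vertices are not adjacent in the complement, so a detour is needed. A
  further vertex of \<open>W\<close> next to neither of them on the cycle gives one of length two.
  Otherwise \<open>W\<close> consists of four consecutive vertices, and the complement of a
  four-vertex path is again a path.\<close>

lemma co_cycle_reach_Suc:
  assumes "n \<ge> 5" "W \<subseteq> {..<n}" "card W \<ge> 4" "x \<in> W" "Suc x mod n \<in> W"
  shows "(x, Suc x mod n) \<in> rtrancl_on W (parcs (co_cycle n))"
proof -
  let ?E = "parcs (co_cycle n)" and ?R = "rtrancl_on W (parcs (co_cycle n))"
  define s where "s i = Suc i mod n" for i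
  have s_lt: "s i < n" for i
    using assms(1) by (simp add: s_def)
  have inj: "i = j" if "s i = s j" "i < n" "j < n" for i j
    using that by (auto simp: s_def intro: Suc_mod_inject)
  \<comment> \<open>With \<open>n \<ge> 5\<close>, at most four successor steps never close
    up.\<close>
  have s_neq: "s i \<noteq> i" "s (s i) \<noteq> i" "s (s (s i)) \<noteq> i" "s (s (s (s i))) \<noteq> i" if "i < n" for i
    using that assms(1) by (auto simp: s_def mod_Suc split: if_splits)
  have E: "(u, v) \<in> ?E" if "u < n" "v < n" "u \<noteq> v" "v \<noteq> s u" "u \<noteq> s v" for u v
    using that by (simp add: parcs_co_cycle_iff s_def)
  have edge: "(u, v) \<in> ?R" if "u \<in> W" "v \<in> W" "u \<noteq> v" "v \<noteq> s u" "u \<noteq> s v" for u v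
    using that assms(2) by (intro rtrancl_on_edge E) auto
  have lt: "u < n" if "u \<in> W" for u
    using that assms(2) by auto
  have xy: "x \<in> W" "s x \<in> W"
    using assms(4,5) by (simp_all add: s_def)
  have fin: "finite W"
    using assms(2) finite_subset by blast
  have "card (W - {x, s x}) \<ge> 2"
    using assms(3) xy fin s_neq(1)[of x] lt[of x] by (subst card_Diff_subset) auto
  then obtain Z where Z: "Z \<subseteq> W - {x, s x}" "card Z = 2"
    by (meson obtain_subset_with_card_n)
  then obtain z z' where "Z = {z, z'}" "z \<noteq> z'"
    by (auto simp: card_2_iff)
  with Z have z: "z \<in> W - {x, s x}" "z' \<in> W - {x, s x}" "z \<noteq> z'"
    by blast+
  have "(x, s x) \<in> ?R"
  proof (cases "\<exists>v\<in>W - {x, s x}. v \<noteq> s (s x) \<and> s v \<noteq> x")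
    case True
    then obtain v where v: "v \<in> W" "v \<noteq> x" "v \<noteq> s x" "v \<noteq> s (s x)" "s v \<noteq> x"
      by blast
    have "(x, v) \<in> ?R" "(v, s x) \<in> ?R"
      using v xy lt inj[of v x] by (auto intro!: edge)
    then show ?thesis
      by (rule rtrancl_on_trans)
  next
    case False
    then have "z = s (s x) \<or> s z = x" "z' = s (s x) \<or> s z' = x"
      using z by blast+
    \<comment> \<open>By injectivity of \<open>s\<close>, \<open>x\<close> has only one predecessor.
      So of the distinct \<open>z\<close> and \<open>z'\<close>, one is \<open>s (s x)\<close> and
      the other is the predecessor \<open>p\<close>.\<close>
    then obtain p where p: "s (s x) \<in> W" "p \<in> W" "s p = x"
      using z lt inj[of z z'] by auto
    have pn: "p < n"
      using p lt by blast
    note neq = s_neq[OF pn] s_neq[OF s_lt[of p]] s_neq[OF s_lt[of "s p"]]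
    note neq = neq neq[symmetric]
    \<comment> \<open>In cycle order the vertices are \<open>p\<close>, \<open>x\<close>,
      \<open>s x\<close>, \<open>s (s x)\<close>; the detour runs \<open>x\<close>,
      \<open>s (s x)\<close>, \<open>p\<close>, \<open>s x\<close>.\<close>
    have "(s p, s (s (s p))) \<in> ?R"
      using p xy neq by (intro edge) simp_all
    moreover have "(s (s (s p)), p) \<in> ?R"
      using p xy neq by (intro edge) simp_all
    moreover have "(p, s (s p)) \<in> ?R"
      using p xy neq by (intro edge) simp_all
    ultimately show ?thesis
      unfolding p(3) by (meson rtrancl_on_trans)
  qed
  then show ?thesis
    by (simp add: s_def)
qed

text \<open>Distinct vertices not adjacent in the complement are consecutive on the cycle, where the
  detour above applies in one direction and symmetry in the other.\<close>

lemma connected_co_cycle: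
  assumes "n \<ge> 5" "W \<subseteq> {..<n}" "card W \<ge> 4"
  shows "Digraph_Component.connected (with_proj (co_cycle n) \<restriction> W)"
  unfolding connected_induced_iff[OF sym_co_cycle]
proof (intro conjI ballI)
  show "W \<noteq> {}"
    using assms(3) by auto
  fix x y assume xy: "x \<in> W" "y \<in> W"
  have sym: "sym (rtrancl_on W (parcs (co_cycle n)))"
    using sym_co_cycle by (rule rtrancl_on_sym)
  have "x < n" "y < n"
    using xy assms(2) by auto
  then consider "x = y" | "(x, y) \<in> parcs (co_cycle n)" | "y = Suc x mod n" | "x = Suc y mod n"
    using parcs_co_cycle_iff by blast
  then show "(x, y) \<in> rtrancl_on W (parcs (co_cycle n))"
  proof cases
    case 1
    then show ?thesis
      using xy by simp
  next
    case 2
    then show ?thesis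
      using xy by (rule rtrancl_on_edge)
  next
    case 3
    then show ?thesis
      using co_cycle_reach_Suc[OF assms, of x] xy by simp
  next
    case 4
    then show ?thesis
      using co_cycle_reach_Suc[OF assms, of y] xy symD[OF sym] by simp
  qed
qed

text \<open>The middle of a consecutive triple is isolated in the complement. Conversely, a vertex
  isolated in \<open>W\<close> has the other two as its cycle neighbours, so \<open>W\<close> is
  consecutive; and three vertices with none isolated are connected.\<close>

lemma connected_co_cycle_triple_iff:
  assumes "n \<ge> 3" "W \<subseteq> {..<n}" "card W = 3"
  shows "Digraph_Component.connected (with_proj (co_cycle n) \<restriction> W) \<longleftrightarrow> W \<notin> cyclic_triples n"
proof -
  have fin: "finite W"
    using assms(2) finite_subset by blast
  have "\<not> Digraph_Component.connected (with_proj (co_cycle n) \<restriction> W)"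
    if "W \<in> cyclic_triples n"
  proof -
    obtain i where i: "i < n" "W = {i, Suc i mod n, Suc (Suc i) mod n}"
      using \<open>W \<in> _\<close> by (auto simp: cyclic_triples_def)
    show ?thesis
    proof (rule not_connected_isolated[OF sym_co_cycle, of "Suc i mod n"])
      show "W \<noteq> {Suc i mod n}"
        using assms(3) by auto
      show "(Suc i mod n, w) \<notin> parcs (co_cycle n)" if "w \<in> W" for w
        using that i by (auto simp: complement_graph_def cycle_graph_def mod_Suc_eq)
    qed (use i in simp)
  qed
  moreover have "Digraph_Component.connected (with_proj (co_cycle n) \<restriction> W)"
    if W: "W \<notin> cyclic_triples n"
    unfolding connected_induced_iff[OF sym_co_cycle]
  proof (intro conjI ballI)
    show "W \<noteq> {}"
      using assms(3) by auto
    fix x y assume xy: "x \<in> W" "y \<in> W"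
    let ?E = "parcs (co_cycle n)"
    have edge: "(u, v) \<in> rtrancl_on W ?E" if "u \<in> W" "v \<in> W" "(u, v) \<in> ?E" for u v
      using that by (intro rtrancl_on_edge)
    have free: "(a, b) \<in> ?E \<or> (a, c) \<in> ?E"
      if abc: "W = {a, b, c}" "a \<noteq> b" "a \<noteq> c" "b \<noteq> c" for a b c
    proof (rule ccontr)
      assume no: "\<not> ?thesis"
      have lt: "a < n" "b < n" "c < n"
        using abc(1) assms(2) by auto
      have inj: "Suc b mod n = Suc c mod n \<Longrightarrow> b = c"
        using lt(2,3) by (rule Suc_mod_inject)
      have "b = Suc a mod n \<or> a = Suc b mod n" "c = Suc a mod n \<or> a = Suc c mod n"
        using no lt abc by (auto simp: parcs_co_cycle_iff)
      \<comment> \<open>\<open>b\<close> and \<open>c\<close> cannot both be successors of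
        \<open>a\<close>, nor both predecessors, so \<open>a\<close> lies between them.\<close>
      then consider "a = Suc c mod n" "b = Suc a mod n" | "a = Suc b mod n" "c = Suc a mod n"
        using inj abc(4) by metis
      then show False
      proof cases
        case 1
        then have "W = {c, Suc c mod n, Suc (Suc c) mod n}"
          using abc(1) by (simp add: mod_Suc_eq insert_commute)
        then show False
          using W lt(3) unfolding cyclic_triples_def by blast
      next
        case 2
        then have "W = {b, Suc b mod n, Suc (Suc b) mod n}"
          using abc(1) by (simp add: mod_Suc_eq insert_commute)
        then show False
          using W lt(2) unfolding cyclic_triples_def by blast
      qed
    qed
    show "(x, y) \<in> rtrancl_on W ?E"
    proof (cases "x = y \<or> (x, y) \<in> ?E")
      case True
      then show ?thesis
        using xy edge by auto
    next
      case False
      have "card (W - {x, y}) = 1"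
        using assms(3) xy fin False by (subst card_Diff_subset) auto
      then obtain z where "W - {x, y} = {z}"
        by (rule card_1_singletonE)
      then have z: "W = {x, y, z}" "z \<noteq> x" "z \<noteq> y"
        using xy by auto
      \<comment> \<open>\<open>x\<close> and \<open>y\<close> are not adjacent but neither is
        isolated, so both are joined to \<open>z\<close>.\<close>
      have "(x, z) \<in> ?E" "(y, z) \<in> ?E"
        using free[of x y z] free[of y x z] z False sym_co_cycle[of n]
        by (auto simp: insert_commute dest: symD)
      then show ?thesis
        using edge z symD[OF sym_co_cycle] by (meson insertCI rtrancl_on_trans)
    qed
  qed
  ultimately show ?thesis
    by blast
qed

text \<open>Leaving out one vertex of a four-cycle leaves three consecutive ones. So every triple is
  excluded for \<open>n = 4\<close>, and the complex is void.\<close>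

lemma cyclic_triples_4:
  assumes "W \<subseteq> {..<4}" "card W = 3"
  shows "W \<in> cyclic_triples 4"
proof -
  have "card ({..<4} - W) = 1"
    using assms finite_subset[OF assms(1)] by (subst card_Diff_subset) auto
  then obtain i where i: "{..<4} - W = {i}"
    by (rule card_1_singletonE)
  have V: "{..<4} = {0, 1, 2, 3 :: nat}"
    by auto
  have "cyclic_triples 4 = {{0, 1, 2}, {1, 2, 3}, {2, 3, 0}, {3, 0, 1}}"
    unfolding cyclic_triples_def V by (simp flip: numeral_2_eq_2)
  moreover have "{0, 1, 2, 3} - {i} \<in> {{0, 1, 2}, {1, 2, 3}, {2, 3, 0}, {3, 0, 1}}"
  proof -
    have "i < 4"
      using i by blast
    then consider "i = 0" | "i = 1" | "i = 2" | "i = 3"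
      by linarith
    then show ?thesis
      by cases (simp_all add: insert_Diff_if insert_commute)
  qed
  moreover have "W = {0, 1, 2, 3} - {i}"
    unfolding V[symmetric] using i assms(1) by blast
  ultimately show ?thesis
    by simp
qed

section \<open>Case distinction on \<open>n\<close> and \<open>r\<close>\<close>

theorem theorem4p12:
  fixes n r :: nat
  assumes "n \<ge> 3" and "r \<ge> 3"
  shows "vertex_decomposable (Sigma_complex r (complement_graph (cycle_graph n)))"
proof -
  consider "n \<le> r" | "r < n" "r \<ge> 4" | "r = 3" "n = 4" | "r = 3" "n \<ge> 5"
    using assms by linarith
  then show ?thesis
  proof cases
    case 1
    then show ?thesis
      unfolding Sigma_complex_co_cycle by (intro vertex_decomposable_co_complex_le) auto
  next
    case 2
    then show ?thesis
      unfolding Sigma_complex_co_cycle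
      \<comment> \<open>\<open>r < n\<close> and \<open>r \<ge> 4\<close> give
        \<open>n \<ge> 5\<close>, so every \<open>r\<close>-set is connected and none is
        excluded.\<close>
      by (intro vertex_decomposable_co_complex_uniform) (auto intro: connected_co_cycle)
  next
    case 3
    then have "Sigma_complex r (co_cycle n) = {}"
      unfolding Sigma_complex_co_cycle
      by (intro co_complex_void) (simp add: connected_co_cycle_triple_iff cyclic_triples_4)
    then show ?thesis
      by (simp add: vertex_decomposable.void)
  next
    case 4
    then have "Sigma_complex r (co_cycle n) = co_complex {..<n} 3 (cyclic_triples n)"
      unfolding Sigma_complex_co_cycle
      by (auto intro!: co_complex_cong simp: connected_co_cycle_triple_iff)
    then show ?thesis
      using vertex_decomposable_cyclic_triples 4 by simp
  qed
qed

end
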